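(* Let $(X,X_+,\mathcal{K},f)$ be an abstract state space, let $\{P_n\}_{n\ge1}$ be a left decreasing sequence of Markov projections of $X$ with $P_n\ne I$ for all $n$, and let $\{T_n\}_{n\ge1}$ be a sequence of Markov operators on $X$, the generating sequence of the NDMC $\{T^{m,n}\}$. Assume that $T_nP_n=P_nT_n$ and $T_nP_n=P_n$ for all $n\in\mathbb{N}$, and write $T_n=P_n+Q_n$. Then the following statements are equivalent: (i) for every $k\in\mathbb{N}$, $\{T^{m,n}\}$ is weakly $P_k$-ergodic; (ii) $\{T^{m,n}\}$ is weakly ergodic with respect to $\{P_n\}$; (iii) for every $m\in\mathbb{N}$ one has $\|Q_{m+n}\cdots Q_{m+1}\|\to0$ as $n\to\infty$. Moreover, for all $m\in\mathbb{N}$ and $n\ge2$, $$\delta_{P_{m+1}}(T^{m,m+n})\le\|Q_{m+n}\cdots Q_{m+1}\|\le2\,\delta_{P_{m+2}}(T^{m+1,m+n}).$$ Moreover, if $P_n\to P$ in norm, then the statements (i)–(iii) are also equivalent to (iv) $\{T^{m,n}\}$ is weakly $P$-ergodic.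
   Context: Abstract state space: $X$ is a real ordered vector space with generating cone $X_+=\{x\in X: x\ge 0\}$ (i.e. $X=X_+-X_+$), $f$ is a strictly positive linear functional on $X$ ($f(x)>0$ for $x>0$), and $\mathcal{K}=\{x\in X_+: f(x)=1\}$. With $U$ the convex hull of $\mathcal{K}\cup(-\mathcal{K})$, put $\|x\|=\inf\{\lambda\in\mathbb{R}_+: x\in\lambda U\}$. $(X,X_+,\mathcal{K},f)$ is an abstract state space if $\|\cdot\|$ is a norm, $X$ is complete for it, and $X_+$ is closed. $X$ always carries this norm, and norms of operators are the induced operator norms. Markov operator: a linear $T:X\to X$ that is positive and satisfies $T(\mathcal{K})\subset\mathcal{K}$ (then $\|T\|=1$). Markov projection: a Markov operator $P$ with $P^2=P$. $\mathbb{N}=\{1,2,\dots\}$. The nonhomogeneous discrete Markov chain (NDMC) generated by $\{T_n\}_{n\ge1}$ is the family $T^{k,n}=T_nT_{n-1}\cdots T_{k+1}$, $0\le k<n$. A sequence of projections $\{P_n\}$ is left decreasing if $P_{n+1}P_n=P_{n+1}$ for all $n\in\mathbb{N}$. Generalized Dobrushin coefficient: for a projection $P\neq I$, $N_P=\{x\in X: Px=0\}$ and $\delta_P(T)=\sup_{x\in N_P,\,x\ne0}\|Tx\|/\|x\|$ for bounded linear $T$; by convention $\delta_I(T)=1$. $\{T^{m,n}\}$ is weakly $P$-ergodic if $\lim_{n\to\infty}\delta_P(T^{m,n})=0$ for every $m\ge0$. It is weakly ergodic with respect to $\{P_n\}$ if $\lim_{n\to\infty}\delta_{P_{m+1}}(T^{m,n})=0$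 for every $m>0$. *)

theory Defs
  imports "HOL-Analysis.Analysis"
begin

definition base :: "('a::ordered_real_vector \<Rightarrow> real) \<Rightarrow> 'a set" where
  "base f = {x. 0 \<le> x \<and> f x = 1}"

definition base_norm :: "('a::ordered_real_vector \<Rightarrow> real) \<Rightarrow> 'a \<Rightarrow> real" where
  "base_norm f x =
     Inf {r. 0 \<le> r \<and> x \<in> (\<lambda>u. r *\<^sub>R u) ` (convex hull (base f \<union> uminus ` base f))}"

text \<open>
  The ordered vector space is the whole type, its cone is the set of elements \<open>\<ge> 0\<close>.
  That the base norm is a norm, and that the space is complete for it, is expressed by
  requiring it to be the norm of the ambient type of class \<open>banach\<close>; all
  topological notions, and operator norms (\<open>onorm\<close>), thus refer to the base norm.
\<close>
locale abstract_state_space =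
  fixes f :: "'a::{ordered_real_vector, banach} \<Rightarrow> real"
  assumes linear_functional: "linear f"
    and strictly_positive: "0 < x \<Longrightarrow> 0 < f x"
    and generating: "\<exists>y z. 0 \<le> y \<and> 0 \<le> z \<and> x = y - z"
    and norm_eq_base_norm: "norm x = base_norm f x"
    and closed_cone: "closed {x::'a. 0 \<le> x}"

definition markov_operator :: "('a::ordered_real_vector \<Rightarrow> real) \<Rightarrow> ('a \<Rightarrow> 'a) \<Rightarrow> bool" where
  "markov_operator f T \<longleftrightarrow> linear T \<and> (\<forall>x\<ge>0. 0 \<le> T x) \<and> T ` base f \<subseteq> base f"

definition markov_projection :: "('a::ordered_real_vector \<Rightarrow> real) \<Rightarrow> ('a \<Rightarrow> 'a) \<Rightarrow> bool" where
  "markov_projection f P \<longleftrightarrow> markov_operator f P \<and> P \<circ> P = P"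

text \<open>Sequences of operators are indexed by \<open>n \<ge> 1\<close>; the value at index 0 is never used.\<close>

definition left_decreasing :: "(nat \<Rightarrow> 'a \<Rightarrow> 'a) \<Rightarrow> bool" where
  "left_decreasing P \<longleftrightarrow> (\<forall>n\<ge>1. P (n + 1) \<circ> P n = P (n + 1))"

text \<open>\<open>op_prod S m n\<close> is the product \<open>S (m + n) \<circ> \<dots> \<circ> S (m + 1)\<close> of \<open>n\<close> operators.\<close>
primrec op_prod :: "(nat \<Rightarrow> 'a \<Rightarrow> 'a) \<Rightarrow> nat \<Rightarrow> nat \<Rightarrow> 'a \<Rightarrow> 'a" where
  "op_prod S m 0 = id"
| "op_prod S m (Suc n) = S (m + Suc n) \<circ> op_prod S m n"

text \<open>\<open>ndmc T k n\<close> is \<open>T n \<circ> \<dots> \<circ> T (k + 1)\<close>, meaningful for \<open>k < n\<close>.\<close>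
definition ndmc :: "(nat \<Rightarrow> 'a \<Rightarrow> 'a) \<Rightarrow> nat \<Rightarrow> nat \<Rightarrow> 'a \<Rightarrow> 'a" where
  "ndmc T k n = op_prod T k (n - k)"

definition dobrushin :: "('a::real_normed_vector \<Rightarrow> 'a) \<Rightarrow> ('a \<Rightarrow> 'a) \<Rightarrow> real" where
  "dobrushin P T =
     (if P = id then 1 else SUP x\<in>{x. P x = 0 \<and> x \<noteq> 0}. norm (T x) / norm x)"

definition weakly_P_ergodic ::
    "('a::real_normed_vector \<Rightarrow> 'a) \<Rightarrow> (nat \<Rightarrow> 'a \<Rightarrow> 'a) \<Rightarrow> bool" where
  "weakly_P_ergodic P T \<longleftrightarrow> (\<forall>m. (\<lambda>n. dobrushin P (ndmc T m n)) \<longlonglongrightarrow> 0)"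

definition weakly_ergodic_wrt ::
    "(nat \<Rightarrow> 'a::real_normed_vector \<Rightarrow> 'a) \<Rightarrow> (nat \<Rightarrow> 'a \<Rightarrow> 'a) \<Rightarrow> bool" where
  "weakly_ergodic_wrt P T \<longleftrightarrow>
     (\<forall>m>0. (\<lambda>n. dobrushin (P (m + 1)) (ndmc T m n)) \<longlonglongrightarrow> 0)"

end

theory Submission
  imports Defs
begin

text \<open>
  Everything rests on three facts. Markov operators are contractions for the base norm, because
  they map its unit ball into itself. The kernels of the \<open>P n\<close> form an increasing chain, because
  \<open>P l \<circ> P k = P l\<close> for \<open>k \<le> l\<close>. And a late projection does not see earlier operators of the chain:
  \<open>P l \<circ> T k = P l \<circ> P k \<circ> T k = P l \<circ> P k = P l\<close> for \<open>k \<le> l\<close>.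

  Since \<open>Q n\<close> is \<open>T n\<close> composed with the complementary projection \<open>I - P n\<close>, and the range of
  \<open>I - P k\<close> is the kernel of \<open>P k\<close>, the correction terms in a product of the \<open>Q n\<close> vanish one after
  the other, and only the first complementary projection survives (\<open>op_prod_Q\<close>):
  \<open>Q (m + n) \<circ> \<dots> \<circ> Q (m + 1) = T (m + n) \<circ> \<dots> \<circ> T (m + 1) \<circ> (I - P (m + 1))\<close>.
  Restricting this identity to the kernel of \<open>P (m + 1)\<close> gives the lower estimate; splitting off
  \<open>Q (m + 1)\<close>, an operator of norm at most 2 with values in the kernel of \<open>P (m + 2)\<close>, gives the
  upper one. The two estimates make (ii) and (iii) equivalent.

  To get (i) from (ii), split the chain at a time \<open>l \<ge> k\<close>: the first part moves the kernel of \<open>P k\<close>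
  into that of \<open>P (l + 1)\<close> without increasing norms, and there (ii) controls the second part
  (\<open>dobrushin_restart\<close>). If finally \<open>P n\<close> tends to \<open>P'\<close>, the kernel of \<open>P'\<close> contains all the
  kernels of the \<open>P n\<close>, so that (iv) implies (i); conversely a vector of the kernel of \<open>P'\<close> differs
  little from its image under \<open>I - P k\<close> when \<open>k\<close> is large, which yields (iv) from (i).
\<close>

section \<open>Markov operators are contractions\<close>

lemma base_normalize:
  assumes "abstract_state_space f" "base f \<noteq> {}" "0 \<le> y"
  shows "\<exists>u\<in>base f. y = f y *\<^sub>R u"
proof (cases "y = 0")
  case True
  have "f 0 = 0" using abstract_state_space.linear_functional[OF assms(1)] by (rule linear_0)
  then show ?thesis using True assms(2) by auto
next
  case False
  then have pos: "0 < f y"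
    using abstract_state_space.strictly_positive[OF assms(1), of y] assms(3) by simp
  have "f (inverse (f y) *\<^sub>R y) = 1"
    using pos linear_scale[OF abstract_state_space.linear_functional[OF assms(1)], of "inverse (f y)" y]
    by simp
  then have "inverse (f y) *\<^sub>R y \<in> base f"
    using pos assms(3) by (simp add: base_def scaleR_nonneg_nonneg)
  moreover have "y = f y *\<^sub>R (inverse (f y) *\<^sub>R y)" using pos by simp
  ultimately show ?thesis by blast
qed

text \<open>
  The infimum in the base norm is over a nonempty set: this is where the cone being generating is
  used. Without it an infimum over the empty set would carry no information.
\<close>
lemma base_norm_set_nonempty:
  assumes S: "abstract_state_space f" and "x \<noteq> 0"
  shows "\<exists>r\<ge>0. x \<in> (\<lambda>u. r *\<^sub>R u) ` (convex hull (base f \<union> uminus ` base f))"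
proof -
  have lin: "linear f" using S by (rule abstract_state_space.linear_functional)
  obtain y z where yz: "0 \<le> y" "0 \<le> z" "x = y - z"
    using abstract_state_space.generating[OF S] by blast
  have f_pos: "0 < f w" if "0 \<le> w" "w \<noteq> 0" for w
    using abstract_state_space.strictly_positive[OF S, of w] that by simp
  have f_nonneg: "0 \<le> f w" if "0 \<le> w" for w
    using f_pos[OF that] linear_0[OF lin] by (cases "w = 0") (auto intro: less_imp_le)
  have "y \<noteq> 0 \<or> z \<noteq> 0" using yz assms(2) by auto
  then have pos: "0 < f y + f z"
    using f_nonneg[OF yz(1)] f_nonneg[OF yz(2)] f_pos[OF yz(1)] f_pos[OF yz(2)] by linarith
  have "inverse (f w) *\<^sub>R w \<in> base f" if "0 \<le> w" "w \<noteq> 0" for w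
    using f_pos[OF that] that linear_scale[OF lin, of "inverse (f w)" w]
    by (simp add: base_def scaleR_nonneg_nonneg)
  then have "base f \<noteq> {}" using \<open>y \<noteq> 0 \<or> z \<noteq> 0\<close> yz by blast
  then have norml: "\<exists>u\<in>base f. w = f w *\<^sub>R u" if "0 \<le> w" for w
    using base_normalize[OF S _ that] by blast
  obtain u v where uv: "u \<in> base f" "y = f y *\<^sub>R u" "v \<in> base f" "z = f z *\<^sub>R v"
    using norml[OF yz(1)] norml[OF yz(2)] by blast
  define r where "r = f y + f z"
  let ?U = "convex hull (base f \<union> uminus ` base f)"
  have "(f y / r) *\<^sub>R u + (f z / r) *\<^sub>R (- v) \<in> ?U"
  proof (rule convexD[OF convex_convex_hull])
    show "u \<in> ?U" "- v \<in> ?U" using uv by (auto intro: hull_inc)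
    show "0 \<le> f y / r" "0 \<le> f z / r"
      using f_nonneg[OF yz(1)] f_nonneg[OF yz(2)] by (auto simp: r_def)
    show "f y / r + f z / r = 1" using pos by (simp add: r_def add_divide_distrib[symmetric])
  qed
  moreover have "x = r *\<^sub>R ((f y / r) *\<^sub>R u + (f z / r) *\<^sub>R (- v))"
    using pos uv yz by (simp add: r_def scaleR_right_diff_distrib)
  ultimately show ?thesis using pos unfolding r_def by (intro exI[of _ "f y + f z"]) auto
qed

lemma markov_operator_contraction:
  assumes S: "abstract_state_space f" and M: "markov_operator f T"
  shows "norm (T x) \<le> norm x"
proof (cases "x = 0")
  case True
  then show ?thesis using M linear_0 by (auto simp: markov_operator_def)
next
  case False
  have lin: "linear T" and img: "T ` base f \<subseteq> base f" using M by (auto simp: markov_operator_def)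
  let ?U = "convex hull (base f \<union> uminus ` base f)"
  let ?R = "\<lambda>x. {r. 0 \<le> r \<and> x \<in> (\<lambda>u. r *\<^sub>R u) ` ?U}"
  have "T ` (base f \<union> uminus ` base f) \<subseteq> base f \<union> uminus ` base f"
    using img linear_neg[OF lin] by fastforce
  then have TU: "T ` ?U \<subseteq> ?U"
    by (metis convex_hull_linear_image[OF lin] hull_mono)
  have "?R x \<subseteq> ?R (T x)" using TU linear_scale[OF lin] by fastforce
  moreover have "?R x \<noteq> {}" using base_norm_set_nonempty[OF S False] by blast
  moreover have "bdd_below (?R (T x))" by (rule bdd_belowI[of _ 0]) auto
  ultimately have "Inf (?R (T x)) \<le> Inf (?R x)" by (rule cInf_superset_mono[rotated 2])
  then show ?thesis
    using abstract_state_space.norm_eq_base_norm[OF S] by (simp add: base_norm_def)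
qed

section \<open>The Dobrushin coefficient as an optimal constant on a kernel\<close>

lemma dobrushin_upper:
  assumes "bounded_linear T" "P \<noteq> id" "P x = 0"
  shows "norm (T x) \<le> dobrushin P T * norm x"
proof (cases "x = 0")
  case True
  then show ?thesis using linear_0[OF bounded_linear.linear[OF assms(1)]] by simp
next
  case False
  have "norm (T x) / norm x \<le> (SUP x\<in>{x. P x = 0 \<and> x \<noteq> 0}. norm (T x) / norm x)"
  proof (rule cSUP_upper)
    show "x \<in> {x. P x = 0 \<and> x \<noteq> 0}" using assms False by simp
    show "bdd_above ((\<lambda>x. norm (T x) / norm x) ` {x. P x = 0 \<and> x \<noteq> 0})"
      using le_onorm[OF assms(1)] by (intro bdd_aboveI[of _ "onorm T"]) auto
  qed
  then show ?thesis using False assms by (simp add: dobrushin_def divide_simps)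
qed

text \<open>
  A linear projection other than the identity has a nonzero kernel vector, so that the supremum
  is taken over a nonempty set.
\<close>
lemma projection_kernel_nontrivial:
  assumes "linear P" "P \<circ> P = P" "P \<noteq> id"
  shows "\<exists>x. P x = 0 \<and> x \<noteq> 0"
proof -
  obtain y where "P y \<noteq> y" using assms(3) by (auto simp: fun_eq_iff)
  then have "P (y - P y) = 0 \<and> y - P y \<noteq> 0"
    using assms(2) by (simp add: linear_diff[OF assms(1)] fun_eq_iff)
  then show ?thesis by blast
qed

lemma dobrushin_least:
  assumes "linear P" "P \<circ> P = P" "P \<noteq> id"
    and "\<And>x. P x = 0 \<Longrightarrow> norm (T x) \<le> c * norm x"
  shows "dobrushin P T \<le> c"
proof -
  have "(SUP x\<in>{x. P x = 0 \<and> x \<noteq> 0}. norm (T x) / norm x) \<le> c"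
    using projection_kernel_nontrivial[OF assms(1-3)] assms(4)
    by (intro cSUP_least) (auto simp: divide_simps)
  then show ?thesis using assms(3) by (simp add: dobrushin_def)
qed

lemma dobrushin_nonneg:
  assumes "linear P" "P \<circ> P = P" "P \<noteq> id" "bounded_linear T"
  shows "0 \<le> dobrushin P T"
proof -
  obtain x where x: "P x = 0" "x \<noteq> 0" using projection_kernel_nontrivial[OF assms(1-3)] by blast
  have "0 \<le> dobrushin P T * norm x"
    using order_trans[OF norm_ge_zero dobrushin_upper[OF assms(4,3) x(1)]] .
  then show ?thesis using x(2) by (simp add: zero_le_mult_iff)
qed

lemma op_prod_add: "op_prod S m (k + n) x = op_prod S (m + k) n (op_prod S m k x)"
  by (induction n) (simp_all add: add.assoc)

lemma ndmc_tendsto_iff: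
  "(\<lambda>n. F (ndmc T m n)) \<longlonglongrightarrow> L \<longleftrightarrow> (\<lambda>n. F (op_prod T m n)) \<longlonglongrightarrow> L"
  using LIMSEQ_offset[of "\<lambda>n. F (ndmc T m n)" m L]
    LIMSEQ_ignore_initial_segment[of "\<lambda>n. F (ndmc T m n)" L m]
  by (auto simp: ndmc_def)

lemma tendsto_zero_squeeze:
  fixes a b :: "nat \<Rightarrow> real"
  assumes "b \<longlonglongrightarrow> 0" "\<And>n. N \<le> n \<Longrightarrow> 0 \<le> a n" "\<And>n. N \<le> n \<Longrightarrow> a n \<le> b n"
  shows "a \<longlonglongrightarrow> 0"
  using assms by (intro Lim_null_comparison[OF _ assms(1)] eventually_sequentiallyI[of N]) auto

section \<open>Contractive chains fixing a decreasing sequence of projections\<close>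

text \<open>
  The Markov property is abstracted to contractivity, so that from here on the argument is one about
  kernels and operator norms in a normed space.
\<close>
locale projected_chain =
  fixes P T Q :: "nat \<Rightarrow> 'a::real_normed_vector \<Rightarrow> 'a"
  assumes P_linear: "1 \<le> n \<Longrightarrow> linear (P n)"
    and T_linear: "1 \<le> n \<Longrightarrow> linear (T n)"
    and P_contraction: "1 \<le> n \<Longrightarrow> norm (P n x) \<le> norm x"
    and T_contraction: "1 \<le> n \<Longrightarrow> norm (T n x) \<le> norm x"
    and P_idem: "1 \<le> n \<Longrightarrow> P n \<circ> P n = P n"
    and P_not_id: "1 \<le> n \<Longrightarrow> P n \<noteq> id"
    and P_Suc_P: "1 \<le> n \<Longrightarrow> P (Suc n) (P n x) = P (Suc n) x"
    and T_P: "1 \<le> n \<Longrightarrow> T n (P n x) = P n x"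
    and P_T: "1 \<le> n \<Longrightarrow> P n (T n x) = P n x"
    and Q_eq: "1 \<le> n \<Longrightarrow> Q n x = T n x - P n x"
begin

lemma P_bounded_linear: "1 \<le> n \<Longrightarrow> bounded_linear (P n)"
  by (rule bounded_linear_intro[where K = 1])
     (use P_contraction in \<open>auto simp: linear_add[OF P_linear] linear_scale[OF P_linear]\<close>)

lemma op_prod_T_linear: "linear (op_prod T m n)"
proof (induction n)
  case (Suc n)
  then show ?case using linear_compose[OF Suc T_linear[of "m + Suc n"]] by (simp add: comp_def)
qed (simp add: linear_iff)

lemma op_prod_T_contraction: "norm (op_prod T m n x) \<le> norm x"
proof (induction n)
  case (Suc n)
  have "norm (T (Suc (m + n)) (op_prod T m n x)) \<le> norm (op_prod T m n x)"
    by (rule T_contraction) simp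
  then show ?case using Suc by simp
qed simp

lemma op_prod_T_bounded_linear: "bounded_linear (op_prod T m n)"
  by (rule bounded_linear_intro[where K = 1])
     (use op_prod_T_contraction in \<open>auto simp: linear_add[OF op_prod_T_linear]
        linear_scale[OF op_prod_T_linear]\<close>)

lemma dobrushin_op_prod_nonneg: "1 \<le> k \<Longrightarrow> 0 \<le> dobrushin (P k) (op_prod T m n)"
  by (rule dobrushin_nonneg[OF P_linear P_idem P_not_id op_prod_T_bounded_linear])

lemma P_P:
  assumes "1 \<le> k" "k \<le> l"
  shows "P l (P k x) = P l x"
  using assms(2)
proof (induction l rule: dec_induct)
  case base
  show ?case using P_idem[OF assms(1)] by (simp add: fun_eq_iff)
next
  case (step l)
  then show ?case using P_Suc_P[of l] assms(1) by (metis order_trans)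
qed

lemma kernel_mono: "1 \<le> k \<Longrightarrow> k \<le> l \<Longrightarrow> P k x = 0 \<Longrightarrow> P l x = 0"
  by (metis P_P P_linear linear_0 order_trans)

lemma P_complement: "1 \<le> k \<Longrightarrow> P k (x - P k x) = 0"
  using P_P[of k k x] by (simp add: linear_diff[OF P_linear])

lemma complement_bound: "1 \<le> k \<Longrightarrow> norm (x - P k x) \<le> 2 * norm x"
  using norm_triangle_ineq4[of x "P k x"] P_contraction[of k x] by linarith

text \<open>
  Insert \<open>P k\<close> between \<open>P l\<close> and \<open>T k\<close>, let it absorb \<open>T k\<close>, and remove it again. Hence the chain
  keeps vectors in the kernel of every later projection.
\<close>
lemma P_op_prod_T:
  assumes "1 \<le> l" "m + n \<le> l"
  shows "P l (op_prod T m n x) = P l x"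
  using assms(2)
proof (induction n)
  case (Suc n)
  have "P l (T (Suc (m + n)) y) = P l y" for y
    using Suc.prems by (metis P_P P_T add_Suc_right le_add1 plus_1_eq_Suc)
  then show ?case using Suc by simp
qed simp

text \<open>
  In the induction step the vector to which the next \<open>Q\<close> is applied already lies in the kernel of
  the corresponding projection, where \<open>Q\<close> and \<open>T\<close> agree. The product has to be nonempty: the
  empty one is the identity.
\<close>
lemma op_prod_Q:
  assumes "1 \<le> n"
  shows "op_prod Q m n x = op_prod T m n (x - P (m + 1) x)"
  using assms
proof (induction n rule: dec_induct)
  case base
  show ?case by (simp add: Q_eq T_P linear_diff[OF T_linear])
next
  case (step n)
  have "P (Suc (m + n)) (x - P (m + 1) x) = 0"
    by (rule kernel_mono[OF _ _ P_complement]) auto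
  then have "P (Suc (m + n)) (op_prod T m n (x - P (m + 1) x)) = 0"
    by (simp add: P_op_prod_T)
  then show ?case using step by (simp add: Q_eq)
qed

lemma op_prod_Q_bounded_linear:
  assumes "1 \<le> n"
  shows "bounded_linear (op_prod Q m n)"
proof -
  have "bounded_linear (\<lambda>x. op_prod T m n (x - P (m + 1) x))"
    by (intro bounded_linear_compose[OF op_prod_T_bounded_linear] bounded_linear_sub
        bounded_linear_ident P_bounded_linear) simp
  moreover have "op_prod Q m n = (\<lambda>x. op_prod T m n (x - P (m + 1) x))"
    using op_prod_Q[OF assms] by blast
  ultimately show ?thesis by simp
qed

lemma dobrushin_le_onorm:
  assumes "1 \<le> n"
  shows "dobrushin (P (m + 1)) (op_prod T m n) \<le> onorm (op_prod Q m n)"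
proof (rule dobrushin_least[OF P_linear P_idem P_not_id])
  fix x assume "P (m + 1) x = 0"
  then have "op_prod T m n x = op_prod Q m n x" using op_prod_Q[OF assms] by simp
  then show "norm (op_prod T m n x) \<le> onorm (op_prod Q m n) * norm x"
    using onorm[OF op_prod_Q_bounded_linear[OF assms]] by simp
qed auto

text \<open>
  The factor 2 is the bound for the norm of \<open>I - P (m + 1)\<close>. The vector \<open>?y\<close> below is
  \<open>Q (m + 1) x\<close>, on which the remaining factors act like a chain in the kernel of \<open>P (m + 2)\<close>.
\<close>
lemma onorm_le_dobrushin:
  "onorm (op_prod Q m (Suc n)) \<le> 2 * dobrushin (P (m + 2)) (op_prod T (m + 1) n)"
proof (rule onorm_bound)
  fix x
  let ?d = "dobrushin (P (m + 2)) (op_prod T (m + 1) n)"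
  let ?y = "T (m + 1) (x - P (m + 1) x)"
  have "P (m + 1) ?y = 0" by (simp add: P_T P_complement del: add_Suc_right One_nat_def)
  then have "P (m + 2) ?y = 0" by (rule kernel_mono[rotated 2]) auto
  then have "norm (op_prod T (m + 1) n ?y) \<le> ?d * norm ?y"
    by (intro dobrushin_upper op_prod_T_bounded_linear P_not_id) auto
  also have "norm ?y \<le> 2 * norm x"
    by (rule order_trans[OF T_contraction complement_bound]) auto
  finally have "norm (op_prod T (m + 1) n ?y) \<le> ?d * (2 * norm x)"
    using dobrushin_op_prod_nonneg[of "m + 2"] by (simp add: mult_left_mono)
  moreover have "op_prod Q m (Suc n) x = op_prod T (m + 1) n ?y"
    using op_prod_Q[of "Suc n" m x] op_prod_add[of T m 1 n] by simp
  ultimately show "norm (op_prod Q m (Suc n) x) \<le> 2 * ?d * norm x"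
    by (simp add: mult_ac)
qed (use dobrushin_op_prod_nonneg[of "m + 2"] in simp)

text \<open>
  The first \<open>j\<close> steps carry the kernel of \<open>P k\<close> into that of \<open>P (m + j + 1)\<close> without increasing
  norms; the remaining steps form a chain started at time \<open>m + j\<close>.
\<close>
lemma dobrushin_restart:
  assumes "1 \<le> k" "k \<le> m + j + 1"
  shows "dobrushin (P k) (op_prod T m (j + n)) \<le> dobrushin (P (m + j + 1)) (op_prod T (m + j) n)"
proof (rule dobrushin_least[OF P_linear P_idem P_not_id])
  fix x assume "P k x = 0"
  let ?d = "dobrushin (P (m + j + 1)) (op_prod T (m + j) n)"
  let ?y = "op_prod T m j x"
  have "P (m + j + 1) ?y = 0"
    using kernel_mono[OF assms \<open>P k x = 0\<close>] by (simp add: P_op_prod_T)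
  then have "norm (op_prod T (m + j) n ?y) \<le> ?d * norm ?y"
    by (intro dobrushin_upper op_prod_T_bounded_linear P_not_id) auto
  also have "\<dots> \<le> ?d * norm x"
    by (intro mult_left_mono op_prod_T_contraction dobrushin_op_prod_nonneg) simp
  finally show "norm (op_prod T m (j + n) x) \<le> ?d * norm x" by (simp add: op_prod_add)
qed (use assms in auto)

section \<open>Equivalence of the ergodicity conditions\<close>

lemma weakly_P_ergodic_shift:
  "weakly_P_ergodic R T \<longleftrightarrow> (\<forall>m. (\<lambda>n. dobrushin R (op_prod T m n)) \<longlonglongrightarrow> 0)"
  by (simp add: weakly_P_ergodic_def ndmc_tendsto_iff)

lemma weakly_ergodic_wrt_shift:
  "weakly_ergodic_wrt P T \<longleftrightarrow> (\<forall>m>0. (\<lambda>n. dobrushin (P (m + 1)) (op_prod T m n)) \<longlonglongrightarrow> 0)"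
  by (simp add: weakly_ergodic_wrt_def ndmc_tendsto_iff)

lemma all_weakly_P_ergodic_iff:
  "(\<forall>k\<ge>1. weakly_P_ergodic (P k) T) \<longleftrightarrow> weakly_ergodic_wrt P T"
proof
  assume "\<forall>k\<ge>1. weakly_P_ergodic (P k) T"
  then show "weakly_ergodic_wrt P T"
    by (auto simp: weakly_P_ergodic_shift weakly_ergodic_wrt_shift)
next
  assume E: "weakly_ergodic_wrt P T"
  show "\<forall>k\<ge>1. weakly_P_ergodic (P k) T"
    unfolding weakly_P_ergodic_shift
  proof (intro allI impI)
    fix k m :: nat assume k: "1 \<le> k"
    have "(\<lambda>n. dobrushin (P (m + k + 1)) (op_prod T (m + k) n)) \<longlonglongrightarrow> 0"
      using E k by (simp add: weakly_ergodic_wrt_shift)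
    then have "(\<lambda>n. dobrushin (P k) (op_prod T m (k + n))) \<longlonglongrightarrow> 0"
      by (rule tendsto_zero_squeeze) (use k in \<open>auto intro!: dobrushin_op_prod_nonneg
            dobrushin_restart[simplified]\<close>)
    then show "(\<lambda>n. dobrushin (P k) (op_prod T m n)) \<longlonglongrightarrow> 0"
      using LIMSEQ_offset[of "\<lambda>n. dobrushin (P k) (op_prod T m n)" k 0]
      by (simp only: add.commute[of _ k])
  qed
qed

lemma weakly_ergodic_wrt_iff_onorm:
  "weakly_ergodic_wrt P T \<longleftrightarrow> (\<forall>m\<ge>1. (\<lambda>n. onorm (op_prod Q m n)) \<longlonglongrightarrow> 0)"
proof
  assume E: "weakly_ergodic_wrt P T"
  show "\<forall>m\<ge>1. (\<lambda>n. onorm (op_prod Q m n)) \<longlonglongrightarrow> 0"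
  proof (intro allI impI)
    fix m :: nat
    have "(\<lambda>n. dobrushin (P (m + 2)) (op_prod T (m + 1) n)) \<longlonglongrightarrow> 0"
      using E[unfolded weakly_ergodic_wrt_shift, rule_format, of "m + 1"] by simp
    then have "(\<lambda>n. 2 * dobrushin (P (m + 2)) (op_prod T (m + 1) n)) \<longlonglongrightarrow> 0"
      by (rule tendsto_mult_right_zero)
    then have "(\<lambda>n. onorm (op_prod Q m (Suc n))) \<longlonglongrightarrow> 0"
      by (rule tendsto_zero_squeeze[OF _ onorm_pos_le[OF op_prod_Q_bounded_linear]
            onorm_le_dobrushin]) simp
    then show "(\<lambda>n. onorm (op_prod Q m n)) \<longlonglongrightarrow> 0" by (rule LIMSEQ_imp_Suc)
  qed
next
  assume O: "\<forall>m\<ge>1. (\<lambda>n. onorm (op_prod Q m n)) \<longlonglongrightarrow> 0"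
  show "weakly_ergodic_wrt P T"
    unfolding weakly_ergodic_wrt_shift
  proof (intro allI impI)
    fix m :: nat assume "0 < m"
    then have "(\<lambda>n. onorm (op_prod Q m n)) \<longlonglongrightarrow> 0" using O by simp
    then show "(\<lambda>n. dobrushin (P (m + 1)) (op_prod T m n)) \<longlonglongrightarrow> 0"
      by (rule tendsto_zero_squeeze[where N = 1, OF _ dobrushin_op_prod_nonneg
            dobrushin_le_onorm]) simp_all
  qed
qed

section \<open>Norm convergent sequences of projections\<close>

context
  fixes P' :: "'a \<Rightarrow> 'a"
  assumes P'_bounded_linear: "bounded_linear P'"
    and P_tendsto: "(\<lambda>n. onorm (\<lambda>x. P n x - P' x)) \<longlonglongrightarrow> 0"
begin

lemma diff_limit_bound:
  assumes "1 \<le> n"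
  shows "norm (P n x - P' x) \<le> onorm (\<lambda>x. P n x - P' x) * norm x"
  by (intro onorm bounded_linear_sub P_bounded_linear P'_bounded_linear assms)

lemma P_pointwise: "(\<lambda>n. P n x) \<longlonglongrightarrow> P' x"
proof (rule LIM_zero_cancel, rule tendsto_norm_zero_cancel)
  have "(\<lambda>n. onorm (\<lambda>x. P n x - P' x) * norm x) \<longlonglongrightarrow> 0"
    using tendsto_mult_left_zero[OF P_tendsto] .
  then show "(\<lambda>n. norm (P n x - P' x)) \<longlonglongrightarrow> 0"
    by (rule tendsto_zero_squeeze[where N = 1, OF _ norm_ge_zero diff_limit_bound])
qed

text \<open>Pass to the limit in \<open>P n \<circ> P k = P n\<close>; in particular the kernel of \<open>P'\<close> contains that of \<open>P k\<close>.\<close>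
lemma limit_P:
  assumes "1 \<le> k"
  shows "P' (P k x) = P' x"
proof -
  have "(\<lambda>n. P n (P k x)) \<longlonglongrightarrow> P' x"
    by (rule Lim_transform_eventually[OF P_pointwise])
       (use P_P[OF assms] in \<open>auto intro!: eventually_sequentiallyI[of k]\<close>)
  then show ?thesis using P_pointwise LIMSEQ_unique by blast
qed

lemma limit_idem: "P' \<circ> P' = P'"
proof
  fix x
  have "(\<lambda>n. P' (P n x)) \<longlonglongrightarrow> P' (P' x)"
    by (rule bounded_linear.tendsto[OF P'_bounded_linear P_pointwise])
  moreover have "(\<lambda>n. P' (P n x)) \<longlonglongrightarrow> P' x"
    by (rule Lim_transform_eventually[OF tendsto_const])
       (use limit_P in \<open>auto intro!: eventually_sequentiallyI[of 1]\<close>)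
  ultimately show "(P' \<circ> P') x = P' x" using LIMSEQ_unique by auto
qed

lemma limit_not_id: "P' \<noteq> id"
proof
  assume "P' = id"
  then have "P 1 = id" using limit_P[of 1] by auto
  then show False using P_not_id[of 1] by simp
qed

lemma dobrushin_le_limit:
  assumes "1 \<le> k"
  shows "dobrushin (P k) (op_prod T m n) \<le> dobrushin P' (op_prod T m n)"
proof (rule dobrushin_least[OF P_linear P_idem P_not_id])
  fix x assume "P k x = 0"
  then have "P' x = 0"
    using limit_P[OF assms, of x] linear_0[OF bounded_linear.linear[OF P'_bounded_linear]] by simp
  then show "norm (op_prod T m n x) \<le> dobrushin P' (op_prod T m n) * norm x"
    by (intro dobrushin_upper op_prod_T_bounded_linear limit_not_id)
qed (use assms in auto)

text \<open>
  For \<open>x\<close> in the kernel of \<open>P'\<close>, decompose \<open>x = (x - P k x) + (P k x - P' x)\<close>; the first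
  summand lies in the kernel of \<open>P k\<close> and has norm at most \<open>2 * norm x\<close>.
\<close>
lemma dobrushin_limit_le:
  assumes "1 \<le> k"
  shows "dobrushin P' (op_prod T m n)
    \<le> 2 * dobrushin (P k) (op_prod T m n) + onorm (\<lambda>x. P k x - P' x)"
proof (rule dobrushin_least[OF bounded_linear.linear[OF P'_bounded_linear] limit_idem limit_not_id])
  fix x assume "P' x = 0"
  let ?S = "op_prod T m n"
  have "?S x = ?S (x - P k x) + ?S (P k x - P' x)"
    using \<open>P' x = 0\<close> by (simp add: linear_add[OF op_prod_T_linear, symmetric])
  then have "norm (?S x) \<le> norm (?S (x - P k x)) + norm (?S (P k x - P' x))"
    by (metis norm_triangle_ineq)
  moreover have "norm (?S (x - P k x)) \<le> dobrushin (P k) ?S * (2 * norm x)"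
    using dobrushin_upper[OF op_prod_T_bounded_linear P_not_id[OF assms] P_complement[OF assms]]
      mult_left_mono[OF complement_bound dobrushin_op_prod_nonneg] assms by (meson order_trans)
  moreover have "norm (?S (P k x - P' x)) \<le> onorm (\<lambda>x. P k x - P' x) * norm x"
    by (rule order_trans[OF op_prod_T_contraction diff_limit_bound[OF assms]])
  ultimately show "norm (?S x)
      \<le> (2 * dobrushin (P k) ?S + onorm (\<lambda>x. P k x - P' x)) * norm x"
    by (simp add: algebra_simps)
qed

lemma all_weakly_P_ergodic_iff_limit:
  "(\<forall>k\<ge>1. weakly_P_ergodic (P k) T) \<longleftrightarrow> weakly_P_ergodic P' T"
proof
  assume "weakly_P_ergodic P' T"
  then have lim: "(\<lambda>n. dobrushin P' (op_prod T m n)) \<longlonglongrightarrow> 0" for m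
    by (simp add: weakly_P_ergodic_shift)
  show "\<forall>k\<ge>1. weakly_P_ergodic (P k) T"
    unfolding weakly_P_ergodic_shift
  proof (intro allI impI)
    fix k m :: nat assume "1 \<le> k"
    then show "(\<lambda>n. dobrushin (P k) (op_prod T m n)) \<longlonglongrightarrow> 0"
      by (intro tendsto_zero_squeeze[OF lim[of m]] dobrushin_op_prod_nonneg dobrushin_le_limit)
  qed
next
  assume E: "\<forall>k\<ge>1. weakly_P_ergodic (P k) T"
  show "weakly_P_ergodic P' T"
    unfolding weakly_P_ergodic_shift
  proof (intro allI LIMSEQ_I)
    fix m and r :: real assume r: "0 < r"
    \<comment> \<open>The index \<open>k\<close> is chosen once, before \<open>n\<close>, to make the error term \<open>P k - P'\<close> small.\<close>
    have "\<forall>\<^sub>F k in sequentially. onorm (\<lambda>x. P k x - P' x) < r / 2"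
      using P_tendsto r by (intro order_tendstoD(2)) auto
    then obtain K where K: "\<And>k. K \<le> k \<Longrightarrow> onorm (\<lambda>x. P k x - P' x) < r / 2"
      by (auto simp: eventually_sequentially)
    define k where "k = max K 1"
    have k: "1 \<le> k" "onorm (\<lambda>x. P k x - P' x) < r / 2" using K by (auto simp: k_def)
    have "(\<lambda>n. dobrushin (P k) (op_prod T m n)) \<longlonglongrightarrow> 0"
      using E k by (simp add: weakly_P_ergodic_shift)
    then have "\<forall>\<^sub>F n in sequentially. dobrushin (P k) (op_prod T m n) < r / 4"
      using r by (intro order_tendstoD(2)) auto
    then obtain N where N: "\<And>n. N \<le> n \<Longrightarrow> dobrushin (P k) (op_prod T m n) < r / 4"
      by (auto simp: eventually_sequentially)
    have "norm (dobrushin P' (op_prod T m n) - 0) < r" if "N \<le> n" for n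
    proof -
      have "0 \<le> dobrushin P' (op_prod T m n)"
        by (rule dobrushin_nonneg[OF bounded_linear.linear[OF P'_bounded_linear] limit_idem
              limit_not_id op_prod_T_bounded_linear])
      then show ?thesis
        using dobrushin_limit_le[OF k(1), of m n] N[OF that] k(2) by simp
    qed
    then show "\<exists>N. \<forall>n\<ge>N. norm (dobrushin P' (op_prod T m n) - 0) < r" by blast
  qed
qed

end

end

section \<open>The equivalence theorem for Markov chains\<close>

theorem theorem6p3:
  fixes f :: "'a::{ordered_real_vector, banach} \<Rightarrow> real"
    and P T Q :: "nat \<Rightarrow> 'a \<Rightarrow> 'a"
  assumes "abstract_state_space f"
    and "\<forall>n\<ge>1. markov_projection f (P n)"
    and "\<forall>n\<ge>1. P n \<noteq> id"
    and "left_decreasing P"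
    and "\<forall>n\<ge>1. markov_operator f (T n)"
    and "\<forall>n\<ge>1. T n \<circ> P n = P n \<circ> T n"
    and "\<forall>n\<ge>1. T n \<circ> P n = P n"
    and "\<forall>n\<ge>1. T n = (\<lambda>x. P n x + Q n x)"
  shows "((\<forall>k\<ge>1. weakly_P_ergodic (P k) T) \<longleftrightarrow> weakly_ergodic_wrt P T)
    \<and> (weakly_ergodic_wrt P T \<longleftrightarrow> (\<forall>m\<ge>1. (\<lambda>n. onorm (op_prod Q m n)) \<longlonglongrightarrow> 0))
    \<and> (\<forall>m\<ge>1. \<forall>n\<ge>2.
          dobrushin (P (m + 1)) (ndmc T m (m + n)) \<le> onorm (op_prod Q m n)
        \<and> onorm (op_prod Q m n) \<le> 2 * dobrushin (P (m + 2)) (ndmc T (m + 1) (m + n)))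
    \<and> (\<forall>P'. bounded_linear P' \<and> (\<lambda>n. onorm (\<lambda>x. P n x - P' x)) \<longlonglongrightarrow> 0 \<longrightarrow>
          ((\<forall>k\<ge>1. weakly_P_ergodic (P k) T) \<longleftrightarrow> weakly_P_ergodic P' T))"
proof -
  interpret projected_chain P T Q
  proof (rule projected_chain.intro)
    fix n :: nat and x :: 'a assume n: "1 \<le> n"
    have P: "markov_operator f (P n)" "P n \<circ> P n = P n"
      using assms(2) n by (auto simp: markov_projection_def)
    have T: "markov_operator f (T n)" using assms(5) n by blast
    show "linear (P n)" "linear (T n)" using P T by (auto simp: markov_operator_def)
    show "norm (P n x) \<le> norm x" "norm (T n x) \<le> norm x"
      using markov_operator_contraction[OF assms(1)] P T by auto
    show "P n \<circ> P n = P n" by (rule P)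
    show "P n \<noteq> id" using assms(3) n by blast
    have "P (n + 1) \<circ> P n = P (n + 1)" using assms(4) n by (simp add: left_decreasing_def)
    then show "P (Suc n) (P n x) = P (Suc n) x" by (simp add: fun_eq_iff)
    have "T n \<circ> P n = P n" "P n \<circ> T n = P n" using assms(6,7) n by auto
    then show "T n (P n x) = P n x" "P n (T n x) = P n x" by (simp_all add: fun_eq_iff)
    have "T n = (\<lambda>x. P n x + Q n x)" using assms(8) n by blast
    then show "Q n x = T n x - P n x" by simp
  qed
  have bounds: "dobrushin (P (m + 1)) (ndmc T m (m + n)) \<le> onorm (op_prod Q m n)
      \<and> onorm (op_prod Q m n) \<le> 2 * dobrushin (P (m + 2)) (ndmc T (m + 1) (m + n))"
    if n: "2 \<le> n" for m n
  proof -
    obtain j where "n = Suc j" using n by (cases n) auto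
    then show ?thesis
      using dobrushin_le_onorm[of n m] onorm_le_dobrushin[of m j] n by (simp add: ndmc_def)
  qed
  show ?thesis
    using all_weakly_P_ergodic_iff weakly_ergodic_wrt_iff_onorm bounds
      all_weakly_P_ergodic_iff_limit by (intro conjI allI impI) blast+
qed

end
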